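(* Let $(A,L,[\cdot,\cdot],\rho)$ be a Lie-Rinehart superalgebra over a field $\mathbb{K}$ of characteristic zero, and let $m=[\cdot,\cdot]\in\mathrm{Der}^1(L,L)$, with symbol map $\rho$. Let $m_t=\sum_{i\ge0}t^im_i$ be a deformation of $(A,L)$ (so $m_0=m$). Then the infinitesimal $m_1$ of the deformation is a 2-cocycle with respect to the deformation cohomology, i.e. $\delta m_1=[m,m_1]=0$.
   Context: $|x|\in\mathbb{Z}_2$ denotes the degree of a homogeneous element; identities are for homogeneous elements. A superderivation of $A$ of degree $|D|$ is a homogeneous linear map with $D(ab)=D(a)b+(-1)^{|a||D|}aD(b)$; $\mathrm{Der}(A)$ is the Lie superalgebra of superderivations with the supercommutator. A Lie-Rinehart superalgebra $(A,L,[\cdot,\cdot],\rho)$ over $\mathbb{K}$ consists of an associative supercommutative $\mathbb{K}$-superalgebra $A$, a Lie superalgebra $L$ over $\mathbb{K}$ (even bracket, $[x,y]=-(-1)^{|x||y|}[y,x]$, $[x,[y,z]]=[[x,y],z]+(-1)^{|x||y|}[y,[x,z]]$), an $A$-module structure on $L$ with $|ax|=|a|+|x|$, and an even Lie superalgebra morphism $\rho:L\to\mathrm{Der}(A)$ with $[x,ay]=\rho(x)(a)y+(-1)^{|a||x|}a[x,y]$ and $\rho(ax)(b)=a\rho(x)(b)$. For $n\ge 0$, $\mathrm{Der}^n(L,L)$ is the space of $\mathbb{K}$-multilinear maps $f:L^{\times(n+1)}\to L$ for which there exists a map $\sigma_f:L^{\otimes n}\to\mathrm{Der}(A)$ (symbol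 map) such that: (1) $f(x_1,\dots,x_i,x_{i+1},\dots,x_{n+1})=-(-1)^{|x_i||x_{i+1}|}f(x_1,\dots,x_{i+1},x_i,\dots,x_{n+1})$ for $1\le i\le n$; (2) $f(x_1,\dots,x_n,ax_{n+1})=(-1)^{|a|(|f|+|x_1|+\cdots+|x_n|)}af(x_1,\dots,x_{n+1})+\sigma_f(x_1,\dots,x_n)(a)x_{n+1}$ for all $a\in A$. Here $|f|=j$ means $|f(x_1,\dots,x_{n+1})|-\sum_i|x_i|=j$ mod 2. For $f\in\mathrm{Der}^p(L,L)$, $g\in\mathrm{Der}^q(L,L)$, set \[(f\circ g)(x_1,\dots,x_{p+q+1})=\sum_{\tau}\varepsilon(\tau,x_1,\dots,x_{p+q+1})\,f\big(g(x_{\tau(1)},\dots,x_{\tau(q+1)}),x_{\tau(q+2)},\dots,x_{\tau(p+q+1)}\big),\] summing over permutations $\tau$ of $\{1,\dots,p+q+1\}$ with $\tau(1)<\cdots<\tau(q+1)$ and $\tau(q+2)<\cdots<\tau(p+q+1)$, where $\varepsilon$ is $\mathrm{sgn}(\tau)$ times the Koszul sign of the permutation of the homogeneous $x_i$. The bracket is $[f,g]=f\circ g-(-1)^{pq}g\circ f$. The deformation complex is $C^n_{def}(L,L)=\mathrm{Der}^{n-1}(L,L)$ with differential $\delta D=[m,D]$. A deformation of $(A,L)$ is a $\mathbb{K}[[t]]$-bilinear map $m_t=\sum_{i\ge0}t^im_i$ ($L\times L\to L[[t]]$, extended to $L[[t]]$ by $\mathbb{K}[[t]]$-bilinearity) with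 $m_0=m$, each $m_i\in\mathrm{Der}^1(L,L)$ even, and $[m_t,m_t]=0$, i.e. $m_t(x,m_t(y,z))=m_t(m_t(x,y),z)+(-1)^{|x||y|}m_t(y,m_t(x,z))$ for all homogeneous $x,y,z\in L$. *)

theory Defs
  imports
    "HOL-Library.Z2"
    "HOL-Combinatorics.Permutations"
    "HOL-Computational_Algebra.Formal_Power_Series"
begin

text \<open>Degrees live in the two-element field \<^typ>\<open>bit\<close>; \<open>psign d\<close> is $(-1)^d$.\<close>

definition psign :: "bit \<Rightarrow> 'k::ring_1" where
  "psign d = (if d = 0 then 1 else - 1)"

definition bilinear_map ::
  "('r::comm_ring_1 \<Rightarrow> 'u::ab_group_add \<Rightarrow> 'u) \<Rightarrow> ('r \<Rightarrow> 'v::ab_group_add \<Rightarrow> 'v)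
    \<Rightarrow> ('r \<Rightarrow> 'w::ab_group_add \<Rightarrow> 'w) \<Rightarrow> ('u \<Rightarrow> 'v \<Rightarrow> 'w) \<Rightarrow> bool" where
  "bilinear_map s1 s2 s3 f \<longleftrightarrow>
     (\<forall>x. module_hom s2 s3 (f x)) \<and> (\<forall>y. module_hom s1 s3 (\<lambda>x. f x y))"

locale super_vector_space = vector_space scale
  for scale :: "'k::field \<Rightarrow> 'v::ab_group_add \<Rightarrow> 'v" (infixr \<open>*s\<close> 75) +
  fixes part :: "bit \<Rightarrow> 'v set"
  assumes subspace_part: "subspace (part d)"
    and part_Int: "part 0 \<inter> part 1 = {0}"
    and part_sum: "\<exists>u\<in>part 0. \<exists>w\<in>part 1. v = u + w"

text \<open>The component of degree \<open>d\<close> of a vector; it is unique in a superspace.\<close>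

definition component :: "(bit \<Rightarrow> 'v::ab_group_add set) \<Rightarrow> bit \<Rightarrow> 'v \<Rightarrow> 'v" where
  "component part d v = (THE u. u \<in> part d \<and> v - u \<in> part (d + 1))"

text \<open>Associativity comes from the class \<^class>\<open>ring\<close>; no unit is assumed.\<close>

locale supercommutative_superalgebra = super_vector_space scale part
  for scale :: "'k::field \<Rightarrow> 'a::ring \<Rightarrow> 'a" (infixr \<open>*s\<close> 75) and part +
  assumes mult_bilinear: "bilinear_map scale scale scale (*)"
    and mult_part: "a \<in> part i \<Longrightarrow> b \<in> part j \<Longrightarrow> a * b \<in> part (i + j)"
    and supercommute: "a \<in> part i \<Longrightarrow> b \<in> part j \<Longrightarrow> a * b = psign (i * j) *s (b * a)"

locale lie_superalgebra = super_vector_space scale part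
  for scale :: "'k::field \<Rightarrow> 'l::ab_group_add \<Rightarrow> 'l" (infixr \<open>*s\<close> 75) and part +
  fixes br :: "'l \<Rightarrow> 'l \<Rightarrow> 'l"
  assumes br_bilinear: "bilinear_map scale scale scale br"
    and br_part: "x \<in> part i \<Longrightarrow> y \<in> part j \<Longrightarrow> br x y \<in> part (i + j)"
    and br_skew: "x \<in> part i \<Longrightarrow> y \<in> part j \<Longrightarrow> br x y = - (psign (i * j) *s br y x)"
    and br_jacobi: "x \<in> part i \<Longrightarrow> y \<in> part j \<Longrightarrow> z \<in> part k \<Longrightarrow>
      br x (br y z) = br (br x y) z + psign (i * j) *s br y (br x z)"

definition superderivations_deg ::
  "('k::field \<Rightarrow> 'a::ring \<Rightarrow> 'a) \<Rightarrow> (bit \<Rightarrow> 'a set) \<Rightarrow> bit \<Rightarrow> ('a \<Rightarrow> 'a) set" where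
  "superderivations_deg scale part d =
     {D. module_hom scale scale D \<and>
         (\<forall>i. \<forall>a\<in>part i. D a \<in> part (i + d)) \<and>
         (\<forall>i j. \<forall>a\<in>part i. \<forall>b\<in>part j.
            D (a * b) = D a * b + scale (psign (i * d)) (a * D b))}"

definition superderivations ::
  "('k::field \<Rightarrow> 'a::ring \<Rightarrow> 'a) \<Rightarrow> (bit \<Rightarrow> 'a set) \<Rightarrow> ('a \<Rightarrow> 'a) set" where
  "superderivations scale part =
     {\<lambda>a. D0 a + D1 a | D0 D1.
        D0 \<in> superderivations_deg scale part 0 \<and> D1 \<in> superderivations_deg scale part 1}"

record ('k, 'a, 'l) lr_data =
  scaleA :: "'k \<Rightarrow> 'a \<Rightarrow> 'a"
  partA :: "bit \<Rightarrow> 'a set"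
  scaleL :: "'k \<Rightarrow> 'l \<Rightarrow> 'l"
  partL :: "bit \<Rightarrow> 'l set"
  act :: "'a \<Rightarrow> 'l \<Rightarrow> 'l"
  lie :: "'l \<Rightarrow> 'l \<Rightarrow> 'l"
  anchor :: "'l \<Rightarrow> 'a \<Rightarrow> 'a"

text \<open>
  The axioms \<open>anchor_linear\<close>, \<open>anchor_even\<close> and \<open>anchor_lie\<close> say that the anchor is an even
  morphism of Lie superalgebras into the superderivations with the supercommutator.
\<close>

locale lie_rinehart_superalgebra =
  fixes R :: "('k::field, 'a::ring, 'l::ab_group_add) lr_data"
  assumes A_superalgebra: "supercommutative_superalgebra (scaleA R) (partA R)"
    and L_superalgebra: "lie_superalgebra (scaleL R) (partL R) (lie R)"
    and act_bilinear: "bilinear_map (scaleA R) (scaleL R) (scaleL R) (act R)"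
    and act_assoc: "act R (a * b) x = act R a (act R b x)"
    and act_part: "a \<in> partA R i \<Longrightarrow> x \<in> partL R j \<Longrightarrow> act R a x \<in> partL R (i + j)"
    and anchor_linear: "module_hom (scaleL R) (scaleA R) (\<lambda>x. anchor R x a)"
    and anchor_even: "x \<in> partL R i \<Longrightarrow>
      anchor R x \<in> superderivations_deg (scaleA R) (partA R) i"
    and anchor_lie: "x \<in> partL R i \<Longrightarrow> y \<in> partL R j \<Longrightarrow>
      anchor R (lie R x y) a =
        anchor R x (anchor R y a) - scaleA R (psign (i * j)) (anchor R y (anchor R x a))"
    and lie_act: "x \<in> partL R i \<Longrightarrow> a \<in> partA R j \<Longrightarrow>
      lie R x (act R a y) =
        act R (anchor R x a) y + scaleL R (psign (j * i)) (act R a (lie R x y))"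
    and anchor_act: "anchor R (act R a x) b = a * anchor R x b"

text \<open>
  A map of \<open>n\<close> arguments is a function on lists. Maps into \<open>L\<close> are normalised to vanish on
  lists of any other length, so that equality of functions is equality of \<open>n\<close>-ary maps.
\<close>

definition multilinear_map ::
  "('k::field \<Rightarrow> 'u::ab_group_add \<Rightarrow> 'u) \<Rightarrow> ('k \<Rightarrow> 'v::ab_group_add \<Rightarrow> 'v)
    \<Rightarrow> nat \<Rightarrow> ('u list \<Rightarrow> 'v) \<Rightarrow> bool" where
  "multilinear_map s1 s2 n f \<longleftrightarrow>
     (\<forall>xs i. length xs = n \<longrightarrow> i < n \<longrightarrow> module_hom s1 s2 (\<lambda>v. f (xs[i := v]))) \<and>
     (\<forall>xs. length xs \<noteq> n \<longrightarrow> f xs = 0)"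

definition homogeneous :: "(bit \<Rightarrow> 'v set) \<Rightarrow> bit list \<Rightarrow> 'v list \<Rightarrow> bool" where
  "homogeneous part ds xs \<longleftrightarrow> list_all2 (\<lambda>d x. x \<in> part d) ds xs"

text \<open>\<open>\<sigma>\<close> is a symbol map of the \<open>(n+1)\<close>-ary map \<open>f\<close> of degree \<open>d\<close>.\<close>

definition is_symbol ::
  "('k::field, 'a::ring, 'l::ab_group_add) lr_data \<Rightarrow> nat \<Rightarrow> bit
    \<Rightarrow> ('l list \<Rightarrow> 'l) \<Rightarrow> ('l list \<Rightarrow> 'a \<Rightarrow> 'a) \<Rightarrow> bool" where
  "is_symbol R n d f \<sigma> \<longleftrightarrow>
     (\<forall>a. multilinear_map (scaleL R) (scaleA R) n (\<lambda>xs. \<sigma> xs a)) \<and>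
     (\<forall>xs. \<sigma> xs \<in> superderivations (scaleA R) (partA R)) \<and>
     (\<forall>ds xs i j a y. length xs = n \<longrightarrow> homogeneous (partL R) ds xs \<longrightarrow>
        a \<in> partA R i \<longrightarrow> y \<in> partL R j \<longrightarrow>
        f (xs @ [act R a y]) =
          scaleL R (psign (i * (d + sum_list ds))) (act R a (f (xs @ [y])))
          + act R (\<sigma> xs a) y)"

definition Der_deg ::
  "('k::field, 'a::ring, 'l::ab_group_add) lr_data \<Rightarrow> nat \<Rightarrow> bit \<Rightarrow> ('l list \<Rightarrow> 'l) set" where
  "Der_deg R n d =
     {f. multilinear_map (scaleL R) (scaleL R) (n + 1) f \<and>
         (\<forall>ds xs. length xs = n + 1 \<longrightarrow> homogeneous (partL R) ds xs \<longrightarrow>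
            f xs \<in> partL R (d + sum_list ds)) \<and>
         (\<forall>ds xs i. length xs = n + 1 \<longrightarrow> homogeneous (partL R) ds xs \<longrightarrow> i < n \<longrightarrow>
            f xs = - scaleL R (psign (ds ! i * ds ! (i + 1)))
                       (f (xs[i := xs ! (i + 1), i + 1 := xs ! i]))) \<and>
         (\<exists>\<sigma>. is_symbol R n d f \<sigma>)}"

definition Der ::
  "('k::field, 'a::ring, 'l::ab_group_add) lr_data \<Rightarrow> nat \<Rightarrow> ('l list \<Rightarrow> 'l) set" where
  "Der R n = {\<lambda>xs. f0 xs + f1 xs | f0 f1. f0 \<in> Der_deg R n 0 \<and> f1 \<in> Der_deg R n 1}"

text \<open>Indices are shifted down by one: the permuted set is \<open>{0..<p+q+1}\<close>.\<close>

definition unshuffles :: "nat \<Rightarrow> nat \<Rightarrow> (nat \<Rightarrow> nat) set" where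
  "unshuffles p q =
     {\<tau>. \<tau> permutes {..<p + q + 1} \<and>
         strict_mono_on {..<q + 1} \<tau> \<and> strict_mono_on {q + 1..<p + q + 1} \<tau>}"

text \<open>
  The Koszul sign of passing from $x_0,\dots,x_{n-1}$ to $x_{\tau(0)},\dots,x_{\tau(n-1)}$,
  where \<open>ds\<close> lists the degrees of the $x_i$: every inverted pair contributes its sign.
\<close>

definition koszul_sign :: "(nat \<Rightarrow> nat) \<Rightarrow> bit list \<Rightarrow> 'k::comm_ring_1" where
  "koszul_sign \<tau> ds =
     (\<Prod>(i, j) \<in> {(i, j). i < j \<and> j < length ds \<and> \<tau> j < \<tau> i}. psign (ds ! \<tau> i * ds ! \<tau> j))"

definition circ_homogeneous ::
  "('k::field, 'a::ring, 'l::ab_group_add) lr_data \<Rightarrow> nat \<Rightarrow> nat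
    \<Rightarrow> ('l list \<Rightarrow> 'l) \<Rightarrow> ('l list \<Rightarrow> 'l) \<Rightarrow> bit list \<Rightarrow> 'l list \<Rightarrow> 'l" where
  "circ_homogeneous R p q f g ds xs =
     (\<Sum>\<tau> \<in> unshuffles p q.
        scaleL R (of_int (sign \<tau>) * koszul_sign \<tau> ds)
          (f (g (map (\<lambda>i. xs ! \<tau> i) [0..<q + 1])
              # map (\<lambda>i. xs ! \<tau> i) [q + 1..<p + q + 1])))"

text \<open>
  The defining formula makes sense for homogeneous arguments only; \<open>circ R p q f g\<close> is its
  multilinear extension, obtained by splitting every argument into its two components.
\<close>

definition circ ::
  "('k::field, 'a::ring, 'l::ab_group_add) lr_data \<Rightarrow> nat \<Rightarrow> nat
    \<Rightarrow> ('l list \<Rightarrow> 'l) \<Rightarrow> ('l list \<Rightarrow> 'l) \<Rightarrow> 'l list \<Rightarrow> 'l" where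
  "circ R p q f g xs =
     (if length xs = p + q + 1
      then \<Sum>ds \<in> {ds. length ds = p + q + 1}.
             circ_homogeneous R p q f g ds (map2 (component (partL R)) ds xs)
      else 0)"

definition der_bracket ::
  "('k::field, 'a::ring, 'l::ab_group_add) lr_data \<Rightarrow> nat \<Rightarrow> nat
    \<Rightarrow> ('l list \<Rightarrow> 'l) \<Rightarrow> ('l list \<Rightarrow> 'l) \<Rightarrow> 'l list \<Rightarrow> 'l" where
  "der_bracket R p q f g xs =
     circ R p q f g xs - scaleL R ((- 1) ^ (p * q)) (circ R q p g f xs)"

definition lie_map ::
  "('k, 'a, 'l::zero) lr_data \<Rightarrow> 'l list \<Rightarrow> 'l" where
  "lie_map R xs = (if length xs = 2 then lie R (xs ! 0) (xs ! 1) else 0)"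

text \<open>The complex is indexed by \<open>n \<ge> 1\<close>.\<close>

definition def_cochains ::
  "('k::field, 'a::ring, 'l::ab_group_add) lr_data \<Rightarrow> nat \<Rightarrow> ('l list \<Rightarrow> 'l) set" where
  "def_cochains R n = Der R (n - 1)"

definition def_differential ::
  "('k::field, 'a::ring, 'l::ab_group_add) lr_data \<Rightarrow> nat
    \<Rightarrow> ('l list \<Rightarrow> 'l) \<Rightarrow> 'l list \<Rightarrow> 'l" where
  "def_differential R n D = der_bracket R 1 (n - 1) (lie_map R) D"

definition def_cocycles ::
  "('k::field, 'a::ring, 'l::ab_group_add) lr_data \<Rightarrow> nat \<Rightarrow> ('l list \<Rightarrow> 'l) set" where
  "def_cocycles R n = {D \<in> def_cochains R n. def_differential R n D = (\<lambda>_. 0)}"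

text \<open>The action of \<open>\<bbbK>[[t]]\<close> on \<open>L[[t]]\<close> induced by the action of the field on \<open>L\<close>.\<close>

definition fps_scale ::
  "('k::comm_ring_1 \<Rightarrow> 'v::ab_group_add \<Rightarrow> 'v) \<Rightarrow> 'k fps \<Rightarrow> 'v fps \<Rightarrow> 'v fps" where
  "fps_scale s c u = Abs_fps (\<lambda>n. \<Sum>i\<le>n. s (fps_nth c i) (fps_nth u (n - i)))"

text \<open>
  \<open>mt\<close> is the \<open>\<bbbK>[[t]]\<close>-bilinear map on \<open>L[[t]]\<close> and \<open>m n\<close> the coefficient of $t^n$ in its
  restriction to constant series.
\<close>

locale lr_deformation = lie_rinehart_superalgebra R
  for R :: "('k::field, 'a::ring, 'l::ab_group_add) lr_data" +
  fixes mt :: "'l fps \<Rightarrow> 'l fps \<Rightarrow> 'l fps" and m :: "nat \<Rightarrow> 'l list \<Rightarrow> 'l"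
  assumes mt_bilinear:
      "bilinear_map (fps_scale (scaleL R)) (fps_scale (scaleL R)) (fps_scale (scaleL R)) mt"
    and mt_expansion: "mt (fps_const x) (fps_const y) = Abs_fps (\<lambda>n. m n [x, y])"
    and m_0: "m 0 = lie_map R"
    and m_Der: "m n \<in> Der_deg R 1 0"
    and mt_jacobi: "x \<in> partL R i \<Longrightarrow> y \<in> partL R j \<Longrightarrow> z \<in> partL R k \<Longrightarrow>
      mt (fps_const x) (mt (fps_const y) (fps_const z)) =
        mt (mt (fps_const x) (fps_const y)) (fps_const z)
        + fps_scale (scaleL R) (fps_const (psign (i * j)))
            (mt (fps_const y) (mt (fps_const x) (fps_const z)))"

end

theory Submission
  imports Defs
begin

text \<open>
  The coefficient of $t$ in the Jacobi identity for $m_t$ on homogeneous $x, y, z$ involves only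
  $m_0 = m$ and $m_1$. Rewriting each of its terms by skew-symmetry as a value of the form
  $f(g(\cdot,\cdot),\cdot)$ turns it into $(m \circ m_1 + m_1 \circ m)(x,y,z) = 0$, and this
  is $[m, m_1](x,y,z)$ because $(-1)^{pq} = -1$ for $p = q = 1$.
\<close>

section \<open>Signs and homogeneous components\<close>

lemma psign_simps [simp]: "psign 0 = 1" "psign 1 = - 1"
  by (simp_all add: psign_def)

text \<open>The definite description in \<open>component\<close> denotes: a decomposition exists by
  \<open>part_sum\<close>, and two candidates differ by an element of both parts, hence by
  0.\<close>

lemma (in super_vector_space) component_in_part: "component part d v \<in> part d"
proof -
  have closed: "x \<in> part e \<Longrightarrow> y \<in> part e \<Longrightarrow> x - y \<in> part e" for x y e
    by (rule subspace_diff[OF subspace_part])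
  obtain a b where ab: "a \<in> part 0" "b \<in> part 1" "v = a + b"
    using part_sum by blast
  \<comment> \<open>In characteristic-two degrees \<open>d + 1\<close> is the other degree, so the
    witness is whichever summand has degree \<open>d\<close>.\<close>
  have ex: "\<exists>u. u \<in> part d \<and> v - u \<in> part (d + 1)"
  proof (cases "d = 0")
    case True
    then show ?thesis using ab by (intro exI[of _ a]) simp
  next
    case False
    then show ?thesis using ab by (intro exI[of _ b]) simp
  qed
  have Int: "part d \<inter> part (d + 1) = {0}"
    using part_Int by (cases d) (simp_all add: Int_commute)
  have "u = w" if "u \<in> part d" "v - u \<in> part (d + 1)" "w \<in> part d" "v - w \<in> part (d + 1)" for u w
  proof -
    have "u - w \<in> part d" using closed that by blast
    moreover have "u - w \<in> part (d + 1)"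
      using closed[OF that(4) that(2)] by simp
    ultimately have "u - w \<in> {0}"
      unfolding Int[symmetric] by blast
    then show ?thesis by simp
  qed
  with ex have "\<exists>!u. u \<in> part d \<and> v - u \<in> part (d + 1)"
    by blast
  from theI'[OF this] show ?thesis
    by (simp add: component_def)
qed

section \<open>Homogeneous elements of \<open>Der\<close>\<close>

text \<open>Elements of \<open>Der\<close> are sums of an even and an odd map; for a homogeneous
  map, zero fills the other summand. Its symbol is again zero.\<close>

lemma zero_in_Der_deg:
  assumes "lie_rinehart_superalgebra R"
  shows "(\<lambda>_. 0) \<in> Der_deg R n d"
proof -
  interpret lie_rinehart_superalgebra R by fact
  interpret A: supercommutative_superalgebra "scaleA R" "partA R" by (rule A_superalgebra)
  interpret L: lie_superalgebra "scaleL R" "partL R" "lie R" by (rule L_superalgebra)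
  have act_0: "act R 0 y = 0" for y
    using act_bilinear module_hom.zero unfolding bilinear_map_def by blast
  have act_0': "act R a 0 = 0" for a
    using act_bilinear module_hom.zero unfolding bilinear_map_def by blast
  have hom: "module_hom (scaleL R) (scaleL R) (\<lambda>_. 0)" "module_hom (scaleL R) (scaleA R) (\<lambda>_. 0)"
    "module_hom (scaleA R) (scaleA R) (\<lambda>_. 0)"
    using L.module_axioms A.module_axioms by (auto simp: module_hom_iff)
  have 0: "0 \<in> partL R e" "0 \<in> partA R e" for e
    using L.subspace_0[OF L.subspace_part] A.subspace_0[OF A.subspace_part] by auto
  have "(\<lambda>_. 0) \<in> superderivations_deg (scaleA R) (partA R) e" for e
    by (auto simp: superderivations_deg_def hom 0)
  then have "(\<lambda>_. 0) \<in> superderivations (scaleA R) (partA R)"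
    unfolding superderivations_def by force
  then have "is_symbol R n d (\<lambda>_. 0) (\<lambda>_ _. 0)"
    by (auto simp: is_symbol_def multilinear_map_def hom act_0 act_0')
  then show ?thesis
    by (auto simp: Der_deg_def multilinear_map_def hom 0)
qed

lemma Der_deg_subset_Der:
  assumes "lie_rinehart_superalgebra R"
  shows "Der_deg R n d \<subseteq> Der R n"
proof
  fix f assume f: "f \<in> Der_deg R n d"
  note z = zero_in_Der_deg[OF assms]
  show "f \<in> Der R n"
  proof (cases "d = 0")
    case True
    then show ?thesis using f z[of n 1] unfolding Der_def by force
  next
    case False
    then show ?thesis using f z[of n 0] unfolding Der_def by force
  qed
qed

lemma Der_deg_1_skew:
  assumes "f \<in> Der_deg R 1 d" "x \<in> partL R i" "y \<in> partL R j"
  shows "f [x, y] = - scaleL R (psign (i * j)) (f [y, x])"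
proof -
  have "\<forall>ds xs i. length xs = 1 + 1 \<longrightarrow> homogeneous (partL R) ds xs \<longrightarrow> i < 1 \<longrightarrow>
            f xs = - scaleL R (psign (ds ! i * ds ! (i + 1)))
                       (f (xs[i := xs ! (i + 1), i + 1 := xs ! i]))"
    using assms(1) unfolding Der_deg_def by blast
  from this[rule_format, of "[x, y]" "[i, j]" 0] show ?thesis
    using assms(2,3) by (simp add: homogeneous_def)
qed

lemma Der_deg_1_part:
  assumes "f \<in> Der_deg R 1 d" "x \<in> partL R i" "y \<in> partL R j"
  shows "f [x, y] \<in> partL R (d + (i + j))"
proof -
  have "\<forall>ds xs. length xs = 1 + 1 \<longrightarrow> homogeneous (partL R) ds xs \<longrightarrow>
            f xs \<in> partL R (d + sum_list ds)"
    using assms(1) unfolding Der_deg_def by blast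
  from this[rule_format, of "[x, y]" "[i, j]"] show ?thesis
    using assms(2,3) by (simp add: homogeneous_def)
qed

section \<open>The composition product of two binary maps\<close>

text \<open>The first two values must increase, so \<tau> is determined by \<tau> 2, which can be 2,
  1 or 0. The last choice is the cycle 0 to 1 to 2 to 0.\<close>

lemma unshuffles_1_1:
  "unshuffles 1 1 = {id, transpose 1 2, transpose 0 1 \<circ> transpose 1 2}"
    (is "_ = {id, ?s, ?c}")
proof (intro equalityI subsetI)
  fix \<tau> :: "nat \<Rightarrow> nat" assume "\<tau> \<in> unshuffles 1 1"
  then have p: "\<tau> permutes {..<3}" and m: "strict_mono_on {..<2} \<tau>"
    by (simp_all add: unshuffles_def numeral_eq_Suc)
  have lt: "\<tau> 0 < \<tau> 1"
    using m by (simp add: strict_mono_on_def)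
  have inj: "\<tau> 2 \<noteq> \<tau> 0" "\<tau> 2 \<noteq> \<tau> 1"
    using permutes_inj[OF p] by (simp_all add: inj_eq)
  have lt3: "\<tau> 0 < 3" "\<tau> 1 < 3" "\<tau> 2 < 3"
    using permutes_in_image[OF p] by auto
  have fix': "\<tau> i = i" if "i \<ge> 3" for i
    using permutes_not_in[OF p] that by simp
  have eqI: "\<tau> = \<sigma>" if "\<tau> 0 = \<sigma> 0" "\<tau> 1 = \<sigma> 1" "\<tau> 2 = \<sigma> 2" "\<And>i. i \<ge> 3 \<Longrightarrow> \<sigma> i = i" for \<sigma>
  proof
    fix i :: nat
    consider "i = 0" | "i = 1" | "i = 2" | "i \<ge> 3" by linarith
    then show "\<tau> i = \<sigma> i" using that fix' by cases auto
  qed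
  consider "\<tau> 0 = 0" "\<tau> 1 = 1" "\<tau> 2 = 2" | "\<tau> 0 = 0" "\<tau> 1 = 2" "\<tau> 2 = 1"
    | "\<tau> 0 = 1" "\<tau> 1 = 2" "\<tau> 2 = 0"
    using lt inj lt3 by linarith
  then show "\<tau> \<in> {id, ?s, ?c}"
  proof cases
    case 1
    then have "\<tau> = id" by (intro eqI) auto
    then show ?thesis by simp
  next
    case 2
    then have "\<tau> = ?s" by (intro eqI) (auto simp: transpose_def)
    then show ?thesis by simp
  next
    case 3
    then have "\<tau> = ?c" by (intro eqI) (auto simp: transpose_def)
    then show ?thesis by simp
  qed
next
  fix \<tau> :: "nat \<Rightarrow> nat" assume \<tau>: "\<tau> \<in> {id, ?s, ?c}"
  have "\<tau> permutes {..<3}"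
    using \<tau> by (auto intro!: permutes_compose permutes_swap_id permutes_id)
  moreover have lt: "\<tau> 0 < \<tau> 1"
    using \<tau> by (auto simp: transpose_def)
  have "strict_mono_on {..<2} \<tau>"
  proof (rule strict_mono_onI)
    fix i j :: nat assume "i \<in> {..<2}" "j \<in> {..<2}" "i < j"
    then have "i = 0" "j = 1" by auto
    with lt show "\<tau> i < \<tau> j" by simp
  qed
  moreover have "strict_mono_on {2..<3} \<tau>"
    by (rule strict_mono_onI) auto
  ultimately show "\<tau> \<in> unshuffles 1 1"
    by (simp add: unshuffles_def numeral_eq_Suc)
qed

text \<open>One term per unshuffle. The transposition is odd and swaps y with z; the cycle is even
  and carries x past both y and z, whence two Koszul factors.\<close>

lemma circ_homogeneous_1_1:
  assumes "module (scaleL R)"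
  shows "circ_homogeneous R 1 1 f g [i, j, k] [x, y, z] =
    f [g [x, y], z] - scaleL R (psign (j * k)) (f [g [x, z], y])
      + scaleL R (psign (i * j) * psign (i * k)) (f [g [y, z], x])"
proof -
  interpret module "scaleL R" by fact
  define s c :: "nat \<Rightarrow> nat" where "s = transpose 1 2" and "c = transpose 0 1 \<circ> transpose 1 2"
  have s: "s 0 = 0" "s 1 = 2" "s 2 = 1" "s (Suc 0) = 2"
    and c: "c 0 = 1" "c 1 = 2" "c 2 = 0" "c (Suc 0) = 2"
    by (auto simp: s_def c_def transpose_def)
  \<comment> \<open>Distinctness splits the sum over \<open>{id, s, c}\<close> into three
    summands.\<close>
  have "s 1 \<noteq> id 1" "c 0 \<noteq> id 0" "s 0 \<noteq> c 0"
    using s c by auto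
  then have distinct: "id \<noteq> s" "id \<noteq> c" "s \<noteq> c"
    by auto
  have sign: "sign s = - 1" "sign c = 1"
    by (simp_all add: s_def c_def sign_compose permutation_swap_id sign_swap_id)
  have pairs: "{(a, b). a < b \<and> b < Suc (Suc (Suc 0)) \<and> \<tau> b < \<tau> a} =
      {(a, b) \<in> {(0, 1), (0, 2), (1, 2)}. \<tau> b < \<tau> a}" for \<tau> :: "nat \<Rightarrow> nat"
    by (auto simp: less_Suc_eq numeral_eq_Suc)
  have inversions: "{(a, b). a < b \<and> b < Suc (Suc (Suc 0)) \<and> (id b :: nat) < id a} = {}"
    "{(a, b). a < b \<and> b < Suc (Suc (Suc 0)) \<and> s b < s a} = {(1, 2)}"
    "{(a, b). a < b \<and> b < Suc (Suc (Suc 0)) \<and> c b < c a} = {(0, 2), (1, 2)}"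
    unfolding pairs using s c by auto
  have koszul: "koszul_sign id [i, j, k] = (1 :: 'a)"
    "koszul_sign s [i, j, k] = (psign (k * j) :: 'a)"
    "koszul_sign c [i, j, k] = (psign (j * i) * psign (k * i) :: 'a)"
    \<comment> \<open>The length of the degree list is evaluated first, so that the index sets match
      \<open>inversions\<close> literally.\<close>
    unfolding koszul_sign_def list.size add_0_right add_Suc_right inversions
    by (simp_all add: s c del: mult_bit_eq_and)
  have upt: "[0..<1 + 1] = [0, 1 :: nat]" "[1 + 1..<1 + 1 + 1] = [2 :: nat]"
    by (simp_all add: upt_rec numeral_eq_Suc)
  have unshuffles: "unshuffles 1 1 = {id, s, c}"
    unfolding s_def c_def by (rule unshuffles_1_1)
  show ?thesis
    unfolding circ_homogeneous_def unshuffles upt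
    using distinct by (simp add: s c sign koszul mult.commute del: mult_bit_eq_and)
qed

section \<open>Coefficients of bilinear maps on formal power series\<close>

context vector_space
begin

unbundle fps_syntax

lemma fps_scale_X_nth:
  "fps_scale scale fps_X u $ n = (case n of 0 \<Rightarrow> 0 | Suc k \<Rightarrow> u $ k)"
proof (cases n)
  case (Suc k)
  \<comment> \<open>Only the coefficient of \<open>fps_X\<close> at 1 is nonzero, and 1 is in range
    because n is a successor.\<close>
  have "fps_scale scale fps_X u $ n = (\<Sum>i\<in>{1}. scale (fps_X $ i) (u $ (n - i)))"
    unfolding fps_scale_def fps_nth_Abs_fps
    using Suc by (intro sum.mono_neutral_right) (auto simp: fps_X_def)
  then show ?thesis using Suc by simp
qed (simp add: fps_scale_def)

lemma fps_scale_const_nth: "fps_scale scale (fps_const c) u $ n = scale c (u $ n)"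
proof -
  have "fps_scale scale (fps_const c) u $ n = (\<Sum>i\<in>{0}. scale (fps_const c $ i) (u $ (n - i)))"
    unfolding fps_scale_def fps_nth_Abs_fps by (intro sum.mono_neutral_right) auto
  then show ?thesis by simp
qed

text \<open>Bilinearity yields only finite sums, so a series is handled by splitting off its
  constant term rather than by an infinite expansion.\<close>

lemma fps_const_plus_X_shift: "u = fps_const (u $ 0) + fps_scale scale fps_X (fps_shift 1 u)"
  by (rule fps_ext) (auto simp: fps_scale_X_nth split: nat.split)

text \<open>Writing u as its constant term plus t times its shift, the first piece contributes its
  \<open>m 1\<close> term. The second contributes the constant coefficient of \<open>mt\<close> at
  the shift, which is the \<open>m 0\<close> term in \<open>u $ 1\<close>.\<close>

lemma bilinear_nth:
  assumes bilinear: "bilinear_map (fps_scale scale) (fps_scale scale) (fps_scale scale) mt"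
    and expansion: "\<And>x y. mt (fps_const x) (fps_const y) = Abs_fps (\<lambda>n. m n [x, y])"
  shows "mt (fps_const x) u $ 1 = m 1 [x, u $ 0] + m 0 [x, u $ 1]"
    and "mt u (fps_const y) $ 1 = m 1 [u $ 0, y] + m 0 [u $ 1, y]"
proof -
  interpret r: module_hom "fps_scale scale" "fps_scale scale" "mt (fps_const x)" for x
    using bilinear by (simp add: bilinear_map_def)
  interpret l: module_hom "fps_scale scale" "fps_scale scale" "\<lambda>x. mt x (fps_const y)" for y
    using bilinear by (simp add: bilinear_map_def)
  have r: "mt (fps_const x) u = Abs_fps (\<lambda>n. m n [x, u $ 0])
      + fps_scale scale fps_X (mt (fps_const x) (fps_shift 1 u))" for x u
    by (subst fps_const_plus_X_shift[of u]) (simp only: r.add r.scale expansion)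
  have l: "mt u (fps_const y) = Abs_fps (\<lambda>n. m n [u $ 0, y])
      + fps_scale scale fps_X (mt (fps_shift 1 u) (fps_const y))" for u y
    by (subst fps_const_plus_X_shift[of u]) (simp only: l.add l.scale expansion)
  have r0: "mt (fps_const x) u $ 0 = m 0 [x, u $ 0]" for x u
    by (subst r) (simp add: fps_scale_X_nth)
  have l0: "mt u (fps_const y) $ 0 = m 0 [u $ 0, y]" for u y
    by (subst l) (simp add: fps_scale_X_nth)
  show "mt (fps_const x) u $ 1 = m 1 [x, u $ 0] + m 0 [x, u $ 1]"
    by (subst r) (simp add: fps_scale_X_nth r0)
  show "mt u (fps_const y) $ 1 = m 1 [u $ 0, y] + m 0 [u $ 1, y]"
    by (subst l) (simp add: fps_scale_X_nth l0)
qed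

end

section \<open>The Jacobi identity to first order and the bracket\<close>

context lr_deformation
begin

lemma L_vector_space: "vector_space (scaleL R)"
  using L_superalgebra by (simp add: lie_superalgebra_def super_vector_space_def)

text \<open>In each nested term the total order 1 falls either on the outer or on the inner map,
  giving two summands.\<close>

lemma jacobi_order_1:
  assumes "x \<in> partL R i" "y \<in> partL R j" "z \<in> partL R k"
  shows "m 1 [x, m 0 [y, z]] + m 0 [x, m 1 [y, z]] =
    m 1 [m 0 [x, y], z] + m 0 [m 1 [x, y], z]
      + scaleL R (psign (i * j)) (m 1 [y, m 0 [x, z]] + m 0 [y, m 1 [x, z]])"
proof -
  interpret V: vector_space "scaleL R" by (rule L_vector_space)
  note nth = V.bilinear_nth[OF mt_bilinear mt_expansion]
  show ?thesis
    using arg_cong[OF mt_jacobi[OF assms], of "\<lambda>u. fps_nth u 1"]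
    by (simp add: nth V.fps_scale_const_nth mt_expansion del: One_nat_def mult_bit_eq_and)
qed

lemma circ_homogeneous_m0_m1:
  assumes x: "x \<in> partL R i" and y: "y \<in> partL R j" and z: "z \<in> partL R k"
  shows "circ_homogeneous R 1 1 (m 0) (m 1) [i, j, k] [x, y, z]
    + circ_homogeneous R 1 1 (m 1) (m 0) [i, j, k] [x, y, z] = 0"
proof -
  interpret V: vector_space "scaleL R" by (rule L_vector_space)
  \<comment> \<open>Every \<open>m q\<close> is even, so the inner value has degree
    \<open>b + c\<close>, which fixes the sign of the swap.\<close>
  have skew: "m p [u, m q [v, w]] = - scaleL R (psign (a * (b + c))) (m p [m q [v, w], u])"
    if "u \<in> partL R a" "v \<in> partL R b" "w \<in> partL R c" for p q u v w a b c
    using Der_deg_1_skew[OF m_Der that(1) Der_deg_1_part[OF m_Der that(2,3)]] by simp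
  have "circ_homogeneous R 1 1 (m 0) (m 1) [i, j, k] [x, y, z]
      + circ_homogeneous R 1 1 (m 1) (m 0) [i, j, k] [x, y, z] =
    m 1 [m 0 [x, y], z] + m 0 [m 1 [x, y], z]
      + scaleL R (psign (i * j)) (m 1 [y, m 0 [x, z]] + m 0 [y, m 1 [x, z]])
      - (m 1 [x, m 0 [y, z]] + m 0 [x, m 1 [y, z]])"
    \<comment> \<open>In the y-term the factor \<open>psign (i * j)\<close> from Jacobi cancels
      against that of the swap, leaving \<open>psign (j * k)\<close>. For fixed degrees all signs
      are 1 or -1, so eight cases suffice.\<close>
    unfolding circ_homogeneous_1_1[OF V.module_axioms] skew[OF x y z] skew[OF y x z]
    by (cases i; cases j; cases k) (simp_all add: algebra_simps)
  with jacobi_order_1[OF x y z] show ?thesis by simp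
qed

lemma der_bracket_m0_m1: "der_bracket R 1 1 (m 0) (m 1) = (\<lambda>_. 0)"
proof
  fix xs
  interpret V: vector_space "scaleL R" by (rule L_vector_space)
  interpret L: lie_superalgebra "scaleL R" "partL R" "lie R" by (rule L_superalgebra)
  \<comment> \<open>The sum defining \<open>circ\<close> vanishes term by term: for each degree list
    the arguments are replaced by homogeneous components.\<close>
  have "circ_homogeneous R 1 1 (m 0) (m 1) ds (map2 (component (partL R)) ds xs)
      + circ_homogeneous R 1 1 (m 1) (m 0) ds (map2 (component (partL R)) ds xs) = 0"
    if xs: "length xs = 3" and ds: "length ds = 3" for ds
  proof -
    obtain x y z where xyz: "xs = [x, y, z]"
      using xs by (auto simp: numeral_eq_Suc length_Suc_conv)
    obtain i j k where ijk: "ds = [i, j, k]"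
      using ds by (auto simp: numeral_eq_Suc length_Suc_conv)
    show ?thesis
      using circ_homogeneous_m0_m1[OF L.component_in_part L.component_in_part L.component_in_part]
      by (simp add: xyz ijk)
  qed
  \<comment> \<open>On lists of any other length both compositions are 0 by convention.\<close>
  then have "circ R 1 1 (m 0) (m 1) xs + circ R 1 1 (m 1) (m 0) xs = 0"
    by (auto simp: circ_def numeral_eq_Suc simp flip: sum.distrib)
  then show "der_bracket R 1 1 (m 0) (m 1) xs = 0"
    by (simp add: der_bracket_def)
qed

end

theorem theorem4p10:
  fixes R :: "('k::field_char_0, 'a::ring, 'l::ab_group_add) lr_data"
    and mt :: "'l fps \<Rightarrow> 'l fps \<Rightarrow> 'l fps"
    and m :: "nat \<Rightarrow> 'l list \<Rightarrow> 'l"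
  assumes "lie_rinehart_superalgebra R"
    and "lr_deformation R mt m"
  shows "m 1 \<in> def_cocycles R 2 \<and> der_bracket R 1 1 (lie_map R) (m 1) = (\<lambda>_. 0)"
proof -
  interpret lr_deformation R mt m by fact
  have "m 1 \<in> Der R 1"
    using Der_deg_subset_Der[OF assms(1)] m_Der by blast
  moreover have "der_bracket R 1 1 (lie_map R) (m 1) = (\<lambda>_. 0)"
    using der_bracket_m0_m1 by (simp only: m_0)
  ultimately show ?thesis
    \<comment> \<open>The complex is shifted by one: 2-cochains are \<open>Der R 1\<close>, and the
      differential on them is \<open>der_bracket R 1 1\<close> with
      \<open>lie_map R\<close>.\<close>
    by (simp add: def_cocycles_def def_cochains_def def_differential_def)
qed

end
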